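(* Let $r,\delta$ be integers with $0 \le \delta < r$. Let $P_r = \phi(2^r-1)/r$ be the number of primitive polynomials of degree $r$ in $\mathbb{Z}_2[x]$, where $\phi$ is Euler's phi function. Then the number of almost primitive polynomials in $\mathbb{Z}_2[x]$ with exponent $r$ and increment $\delta$ is $2^{\max(0,\delta-1)} P_r$.
   Context: $\mathbb{Z}_2 = \mathrm{GF}(2)$ is the field with two elements. A polynomial $P\in\mathbb{Z}_2[x]$ with $P(0)\ne 0$ has period $\rho$ if $\rho$ is the least positive integer such that $x^\rho \equiv 1 \pmod{P(x)}$. A polynomial $P \in \mathbb{Z}_2[x]$ of degree $n>0$ is primitive if it is irreducible and has period $2^n-1$. A polynomial $P \in \mathbb{Z}_2[x]$ of degree $n$ is almost primitive if $P(0)\neq 0$ and $P$ has a primitive factor of degree $r$ for some $r > n/2$; one then says that $P$ has exponent $r$ and increment $n-r$. *)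

theory Defs
  imports
    "HOL-Library.Z2"
    "HOL-Computational_Algebra.Polynomial_Factorial"
    "HOL-Number_Theory.Cong"
    "HOL-Number_Theory.Totient"
begin

text \<open>The field with two elements is the library type \<open>bit\<close>.\<close>

definition has_period :: "bit poly \<Rightarrow> nat \<Rightarrow> bool" where
  "has_period P \<rho> \<longleftrightarrow>
     poly P 0 \<noteq> 0 \<and> 0 < \<rho> \<and> [monom 1 \<rho> = 1] (mod P) \<and>
     (\<forall>k. 0 < k \<and> [monom 1 k = 1] (mod P) \<longrightarrow> \<rho> \<le> k)"

definition primitive_poly :: "bit poly \<Rightarrow> bool" where
  "primitive_poly P \<longleftrightarrow>
     0 < degree P \<and> irreducible P \<and> has_period P (2 ^ degree P - 1)"

definition has_exponent :: "bit poly \<Rightarrow> nat \<Rightarrow> bool" where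
  "has_exponent P r \<longleftrightarrow>
     poly P 0 \<noteq> 0 \<and> real r > real (degree P) / 2 \<and>
     (\<exists>Q. primitive_poly Q \<and> degree Q = r \<and> Q dvd P)"

definition almost_primitive :: "bit poly \<Rightarrow> bool" where
  "almost_primitive P \<longleftrightarrow> (\<exists>r. has_exponent P r)"

text \<open>The increment is \<open>degree P - r\<close>; it is written additively to avoid truncated subtraction.\<close>

definition has_exponent_increment :: "bit poly \<Rightarrow> nat \<Rightarrow> nat \<Rightarrow> bool" where
  "has_exponent_increment P r \<delta> \<longleftrightarrow> has_exponent P r \<and> degree P = r + \<delta>"

end

theory Submission
  imports "HOL-Algebra.Algebraic_Closure_Type" Defs
begin

text \<open>
  In an algebraic closure of the field with two elements there are exactly \<open>totient N\<close> elements
  of multiplicative order \<open>N = 2 ^ r - 1\<close>, because for odd \<open>n\<close> the polynomial \<open>x ^ n - 1\<close> is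
  separable. The minimal polynomials of these elements are the primitive polynomials of degree
  \<open>r\<close>, and each of them has \<open>r\<close> distinct roots, all of order \<open>N\<close>; this gives \<open>P\<^sub>r\<close>.
  An almost primitive polynomial with exponent \<open>r\<close> and increment \<open>\<delta> < r\<close> factors uniquely
  as a primitive polynomial of degree \<open>r\<close> times a cofactor of degree \<open>\<delta>\<close> with constant
  coefficient 1, since a second primitive factor of degree \<open>r\<close> would have to divide the cofactor.
\<close>

subsection \<open>Counting elements of given multiplicative order\<close>

text \<open>Separability forces all roots to be simple: splitting off one root leaves a quotient
  that avoids this root and is again separable, so induction on the degree applies.\<close>

lemma card_roots_eq_degree:
  fixes p :: "'a :: alg_closed_field poly"
  assumes "p \<noteq> 0" and "\<And>a. poly p a = 0 \<Longrightarrow> poly (pderiv p) a \<noteq> 0"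
  shows "card {a. poly p a = 0} = degree p"
  using assms
proof (induction "degree p" arbitrary: p)
  case 0
  then obtain c where "p = [:c:]" "c \<noteq> 0"
    by (metis degree_eq_zeroE pCons_0_0)
  thus ?case by simp
next
  case (Suc n)
  then obtain a where a: "poly p a = 0"
    by (metis alg_closed_imp_poly_has_root zero_less_Suc)
  then obtain q where q: "p = [:- a, 1:] * q"
    by (auto simp: poly_eq_0_iff_dvd)
  have "q \<noteq> 0" using q Suc.prems(1) by auto
  hence deg: "degree p = Suc (degree q)"
    unfolding q by (subst degree_mult_eq) auto
  \<comment> \<open>At \<open>a\<close> the second summand vanishes, so \<open>q\<close> does not
    vanish there. At a root of \<open>q\<close> the first summand vanishes, so
    \<open>pderiv q\<close> does not.\<close>
  have pd: "pderiv p = q + [:- a, 1:] * pderiv q"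
    unfolding q by (subst pderiv_mult) (simp add: pderiv_pCons)
  have qa: "poly q a \<noteq> 0"
    using Suc.prems(2)[OF a] by (auto simp: pd)
  have "poly (pderiv q) b \<noteq> 0" if "poly q b = 0" for b
  proof -
    have "poly p b = 0" using that by (simp add: q)
    with Suc.prems(2)[of b] that show ?thesis by (auto simp: pd)
  qed
  hence IH: "card {b. poly q b = 0} = degree q"
    using Suc.hyps deg \<open>q \<noteq> 0\<close> by auto
  have "{b. poly p b = 0} = insert a {b. poly q b = 0}"
    by (auto simp: q)
  thus ?case
    using IH qa deg poly_roots_finite[OF \<open>q \<noteq> 0\<close>] by simp
qed

lemma degree_monom_diff:
  fixes q :: "'a :: comm_ring_1 poly"
  assumes "degree q < n"
  shows "degree (monom 1 n - q) = n"
  using degree_add_eq_left[of "- q" "monom 1 n"] assms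
  by (simp add: degree_monom_eq)

text \<open>As \<open>n\<close> is nonzero in the field, the derivative
  \<open>n * x ^ (n - 1)\<close> can vanish only at 0, where \<open>x ^ n - 1\<close> does
  not.\<close>

lemma card_roots_of_unity:
  assumes "of_nat n \<noteq> (0 :: 'a :: alg_closed_field)"
  shows "card {x :: 'a. x ^ n = 1} = n"
proof -
  define p :: "'a poly" where "p = monom 1 n - 1"
  have n: "n > 0" using assms by (cases n) auto
  have "coeff p n = 1" using n by (simp add: p_def)
  hence "p \<noteq> 0" by auto
  have deg: "degree p = n"
    using n by (simp add: p_def degree_monom_diff)
  have ev: "poly p x = x ^ n - 1" for x
    by (simp add: p_def poly_monom)
  have "poly (pderiv p) x \<noteq> 0" if "poly p x = 0" for x
    using that n assms by (auto simp: ev p_def pderiv_diff pderiv_monom poly_monom power_0_left)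
  from card_roots_eq_degree[OF \<open>p \<noteq> 0\<close> this] show ?thesis
    by (simp add: ev deg)
qed

text \<open>The divisibility form makes the order unique by antisymmetry; \<open>n = 0\<close>
  encodes infinite order.\<close>

definition exact_order :: "'a :: monoid_mult \<Rightarrow> nat \<Rightarrow> bool" where
  "exact_order x n \<longleftrightarrow> (\<forall>k. x ^ k = 1 \<longleftrightarrow> n dvd k)"

lemma exact_order_unique: "exact_order x m \<Longrightarrow> exact_order x n \<Longrightarrow> m = n"
  by (meson dvd_antisym dvd_refl exact_order_def)

text \<open>Bridge from the least-exponent form in \<open>has_period\<close>, by division with
  remainder.\<close>

lemma exact_order_Least:
  fixes x :: "'a :: monoid_mult"
  assumes "0 < n" "x ^ n = 1" and least: "\<And>k. 0 < k \<Longrightarrow> x ^ k = 1 \<Longrightarrow> n \<le> k"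
  shows "exact_order x n"
  unfolding exact_order_def
proof (intro allI iffI)
  fix k assume k: "x ^ k = 1"
  have "x ^ k = x ^ (k mod n) * (x ^ n) ^ (k div n)"
    by (metis mod_mult_div_eq power_add power_mult)
  hence "x ^ (k mod n) = 1" using k assms by simp
  with least[of "k mod n"] show "n dvd k"
    using \<open>0 < n\<close> by (meson dvd_eq_mod_eq_0 leD mod_less_divisor neq0_conv)
next
  fix k assume "n dvd k"
  thus "x ^ k = 1" using assms by (auto simp: power_mult)
qed

lemma exact_order_exists:
  fixes x :: "'a :: monoid_mult"
  assumes "0 < n" "x ^ n = 1"
  obtains d where "exact_order x d"
proof -
  define d where "d = (LEAST k. 0 < k \<and> x ^ k = 1)"
  have "0 < d \<and> x ^ d = 1"
    unfolding d_def by (rule LeastI[of _ n]) (use assms in auto)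
  moreover have "d \<le> k" if "0 < k" "x ^ k = 1" for k
    unfolding d_def by (rule Least_le) (use that in auto)
  ultimately show thesis by (intro that exact_order_Least) auto
qed

text \<open>The \<open>n\<close> roots of unity are partitioned by their orders
  \<open>d dvd n\<close>. Comparison with Gauss's identity, that the totients of the divisors of
  \<open>n\<close> sum to \<open>n\<close>, leaves only the term \<open>d = n\<close> once the
  proper divisors are settled by induction.\<close>

lemma card_exact_order:
  assumes "of_nat n \<noteq> (0 :: 'a :: alg_closed_field)"
  shows "card {x :: 'a. exact_order x n} = totient n"
  using assms
proof (induction n rule: less_induct)
  case (less n)
  let ?O = "\<lambda>d. {x :: 'a. exact_order x d}"
  have n: "n > 0" using less.prems by (cases n) auto
  have nz: "of_nat d \<noteq> (0 :: 'a)" if "d dvd n" for d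
    using less.prems that by auto
  have fin: "finite {x :: 'a. x ^ n = 1}"
    using card_roots_of_unity[OF less.prems] n by (metis card_ge_0_finite)
  have sub: "?O d \<subseteq> {x. x ^ n = 1}" if "d dvd n" for d
    using that by (auto simp: exact_order_def)
  have "{x :: 'a. x ^ n = 1} = (\<Union>d\<in>{d. d dvd n}. ?O d)"
  proof (intro equalityI subsetI)
    fix x :: 'a assume "x \<in> {x. x ^ n = 1}"
    hence x: "x ^ n = 1" by simp
    obtain d where "exact_order x d" using exact_order_exists[OF n x] .
    with x show "x \<in> (\<Union>d\<in>{d. d dvd n}. ?O d)" by (auto simp: exact_order_def)
  qed (use sub in auto)
  hence "n = card (\<Union>d\<in>{d. d dvd n}. ?O d)"
    using card_roots_of_unity[OF less.prems] by simp
  also have "\<dots> = (\<Sum>d | d dvd n. card (?O d))"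
    using n fin sub by (intro card_UN_disjoint) (auto dest: exact_order_unique intro: finite_subset)
  also have "{d. d dvd n} = insert n {d. d dvd n \<and> d < n}"
    using n by (auto dest: dvd_imp_le)
  also have "(\<Sum>d\<in>\<dots>. card (?O d)) = card (?O n) + (\<Sum>d | d dvd n \<and> d < n. card (?O d))"
    by (subst sum.insert) auto
  also have "(\<Sum>d | d dvd n \<and> d < n. card (?O d)) = (\<Sum>d | d dvd n \<and> d < n. totient d)"
    using less.IH nz by (intro sum.cong) auto
  finally have "n = card (?O n) + (\<Sum>d | d dvd n \<and> d < n. totient d)" .
  moreover have "n = totient n + (\<Sum>d | d dvd n \<and> d < n. totient d)"
  proof -
    have "{d. d dvd n} = insert n {d. d dvd n \<and> d < n}"
      using n by (auto dest: dvd_imp_le)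
    thus ?thesis using totient_divisor_sum[of n] by simp
  qed
  ultimately show ?case by simp
qed

subsection \<open>Evaluation in the algebraic closure\<close>

definition eval_ac :: "'a :: field poly \<Rightarrow> 'a alg_closure \<Rightarrow> 'a alg_closure" where
  "eval_ac p x = poly (map_poly to_ac p) x"

lemma eval_ac_0 [simp]: "eval_ac 0 x = 0"
  by (simp add: eval_ac_def)

lemma eval_ac_pCons [simp]: "eval_ac (pCons a p) x = to_ac a + x * eval_ac p x"
  by (simp add: eval_ac_def map_poly_pCons)

lemma eval_ac_1 [simp]: "eval_ac 1 x = 1"
  by (simp add: one_pCons)

lemma eval_ac_add [simp]: "eval_ac (p + q) x = eval_ac p x + eval_ac q x"
  by (induction p q rule: poly_induct2) (simp_all add: algebra_simps del: add_bit_eq_xor)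

lemma eval_ac_smult [simp]: "eval_ac (smult a p) x = to_ac a * eval_ac p x"
  by (induction p) (simp_all add: algebra_simps)

lemma eval_ac_mult [simp]: "eval_ac (p * q) x = eval_ac p x * eval_ac q x"
  by (induction p) (simp_all add: algebra_simps)

lemma eval_ac_diff [simp]: "eval_ac (p - q) x = eval_ac p x - eval_ac q x"
  using eval_ac_add[of "p - q" q x] by simp

lemma eval_ac_monom [simp]: "eval_ac (monom a n) x = to_ac a * x ^ n"
  by (induction n) (simp_all add: monom_Suc monom_0 algebra_simps)

lemma eval_ac_mod: "eval_ac m x = 0 \<Longrightarrow> eval_ac (p mod m) x = eval_ac p x"
  using eval_ac_add[of "p div m * m" "p mod m" x] by simp

lemma eval_ac_root_exists:
  assumes "degree p > 0"
  obtains x where "eval_ac p x = 0"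
  using alg_closed_imp_poly_has_root[of "map_poly to_ac p"] assms
  by (auto simp: eval_ac_def degree_map_poly)

lemma finite_eval_ac_roots: "p \<noteq> 0 \<Longrightarrow> finite {x. eval_ac p x = 0}"
  unfolding eval_ac_def by (rule poly_roots_finite) (simp add: map_poly_eq_0_iff)

lemma card_eval_ac_roots_le: "p \<noteq> 0 \<Longrightarrow> card {x. eval_ac p x = 0} \<le> degree p"
  unfolding eval_ac_def
  using card_poly_roots_bound[of "map_poly to_ac p"]
  by (simp add: degree_map_poly map_poly_eq_0_iff)

text \<open>Both \<open>p\<close> and its cofactor have at most as many roots as their degrees;
  since \<open>q\<close> attains its degree, neither bound can be strict.\<close>

lemma card_eval_ac_roots_dvd:
  assumes "p dvd q" "q \<noteq> 0" "card {x. eval_ac q x = 0} = degree q"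
  shows "card {x. eval_ac p x = 0} = degree p"
proof -
  obtain s where s: "q = p * s" using assms(1) by auto
  hence nz: "p \<noteq> 0" "s \<noteq> 0" using assms(2) by auto
  have "{x. eval_ac q x = 0} = {x. eval_ac p x = 0} \<union> {x. eval_ac s x = 0}"
    by (auto simp: s)
  hence "degree q \<le> card {x. eval_ac p x = 0} + card {x. eval_ac s x = 0}"
    using assms(3) card_Un_le by metis
  moreover have "degree q = degree p + degree s"
    using nz by (simp add: s degree_mult_eq)
  ultimately show ?thesis
    using card_eval_ac_roots_le[OF nz(1)] card_eval_ac_roots_le[OF nz(2)] by linarith
qed

text \<open>A nonzero annihilator of least degree divides every annihilator, as the remainder also
  vanishes at \<open>x\<close>. In a factorization of it, one factor vanishes at \<open>x\<close>
  and is thus a multiple of it, so the other factor is a unit.\<close>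

lemma minimal_polynomial_exists:
  fixes x :: "'a :: field alg_closure"
  obtains m :: "'a poly"
  where "m \<noteq> 0" "irreducible m" "\<And>p. eval_ac p x = 0 \<longleftrightarrow> m dvd p"
proof -
  obtain p0 :: "'a poly" where p0: "p0 \<noteq> 0" "eval_ac p0 x = 0"
    using alg_closure_algebraic unfolding eval_ac_def by blast
  define m where "m = arg_min degree (\<lambda>p :: 'a poly. p \<noteq> 0 \<and> eval_ac p x = 0)"
  have m: "m \<noteq> 0" "eval_ac m x = 0"
    unfolding m_def using arg_min_natI[of "\<lambda>p. p \<noteq> 0 \<and> eval_ac p x = 0" p0 degree] p0 by auto
  have least: "degree m \<le> degree p" if "p \<noteq> 0" "eval_ac p x = 0" for p
    unfolding m_def using that by (intro arg_min_nat_le) auto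
  have dvd: "eval_ac p x = 0 \<longleftrightarrow> m dvd p" for p
  proof
    assume "eval_ac p x = 0"
    hence "eval_ac (p mod m) x = 0" using m eval_ac_mod by metis
    hence "p mod m = 0"
      using least[of "p mod m"] degree_mod_less[of m p] m by (meson leD)
    thus "m dvd p" by auto
  qed (use m in auto)
  have "irreducible m"
  proof (rule comm_semiring_1_class.irreducibleI)
    show "m \<noteq> 0" by fact
    show "\<not> m dvd 1" using dvd[of 1] by simp
    fix a b assume ab: "m = a * b"
    hence "eval_ac a x = 0 \<or> eval_ac b x = 0" using m by simp
    hence "m dvd a \<or> m dvd b" using dvd by simp
    thus "a dvd 1 \<or> b dvd 1"
      using ab m by (metis dvd_mult_cancel_left dvd_mult_cancel_right mult.right_neutral mult_1 mult_eq_0_iff)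
  qed
  from that[OF m(1) this dvd] show thesis .
qed

text \<open>An irreducible polynomial vanishing at \<open>x\<close> is associated to the minimal
  polynomial of \<open>x\<close>.\<close>

lemma irreducible_eval_ac_eq_0_iff:
  assumes "irreducible p" "eval_ac p x = 0"
  shows "eval_ac q x = 0 \<longleftrightarrow> p dvd q"
proof -
  obtain m where m: "irreducible m" "\<And>q. eval_ac q x = 0 \<longleftrightarrow> m dvd q"
    using minimal_polynomial_exists[of x] by metis
  have "m dvd p" using assms(2) m(2) by simp
  hence "p dvd m"
    using assms(1) m(1) by (meson irreducibleD' irreducible_not_unit)
  with \<open>m dvd p\<close> show ?thesis using m(2) by (meson dvd_trans)
qed

subsection \<open>Polynomials over the field with two elements\<close>

text \<open>The only nonzero constant is 1, so associated polynomials coincide.\<close>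

lemma bit_poly_dvd_antisym:
  fixes p q :: "bit poly"
  assumes "p dvd q" "q dvd p"
  shows "p = q"
proof (cases "p = 0")
  case False
  obtain c where c: "q = p * c" using assms(1) by auto
  have "q \<noteq> 0" using False assms(2) by auto
  hence "c \<noteq> 0" using c by auto
  have "degree q = degree p"
    using assms False \<open>q \<noteq> 0\<close> by (meson dvd_imp_degree_le le_antisym)
  hence "degree c = 0" using c False \<open>c \<noteq> 0\<close> by (simp add: degree_mult_eq)
  then obtain a where "c = [:a:]" by (rule degree_eq_zeroE)
  with \<open>c \<noteq> 0\<close> have "c = 1" by (simp add: one_pCons)
  thus ?thesis using c by simp
qed (use assms in auto)

lemma of_nat_ac_bit_neq_0: "odd n \<Longrightarrow> of_nat n \<noteq> (0 :: bit alg_closure)"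
proof -
  assume "odd n"
  hence "of_nat n = (1 :: bit)" using Z2.bit_eq_iff even_of_nat by blast
  thus ?thesis by (metis to_ac_1 to_ac_of_nat zero_neq_one)
qed

text \<open>In characteristic 2 squaring is additive, and it fixes the coefficients 0 and 1; iterate
  \<open>n\<close> times.\<close>

lemma eval_ac_bit_frobenius:
  fixes p :: "bit poly"
  shows "eval_ac p x ^ (2 ^ n) = eval_ac p (x ^ (2 ^ n))"
proof (induction n)
  case (Suc n)
  have two: "(2 :: bit alg_closure) = 0"
    using to_ac_numeral[of "num.Bit0 num.One", where ?'a = bit] by simp
  have sq: "eval_ac p y ^ 2 = eval_ac p (y ^ 2)" for y and p :: "bit poly"
  proof (induction p)
    case (pCons a p)
    have "to_ac a ^ 2 = to_ac a" by (cases a) auto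
    thus ?case using pCons.IH two by (simp add: power2_sum power_mult_distrib)
  qed simp
  have "eval_ac p x ^ (2 ^ Suc n) = (eval_ac p x ^ (2 ^ n)) ^ 2"
    by (simp add: power_mult mult.commute flip: power_mult)
  thus ?case by (simp add: Suc.IH sq mult.commute flip: power_mult)
qed simp

text \<open>The coefficient condition expresses degree below \<open>n\<close> while keeping the zero
  polynomial, even for \<open>n = 0\<close>. Each new constant coefficient doubles the
  count.\<close>

lemma bit_polys_coeff_bound:
  "finite {p :: bit poly. \<forall>i\<ge>n. coeff p i = 0}"
  "card {p :: bit poly. \<forall>i\<ge>n. coeff p i = 0} = 2 ^ n"
proof -
  have "finite {p :: bit poly. \<forall>i\<ge>n. coeff p i = 0} \<and> card {p :: bit poly. \<forall>i\<ge>n. coeff p i = 0} = 2 ^ n"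
  proof (induction n)
    case 0
    have "{p :: bit poly. \<forall>i\<ge>0. coeff p i = 0} = {0}" by (auto simp: poly_eq_iff)
    thus ?case by simp
  next
    case (Suc n)
    let ?B = "\<lambda>n. {p :: bit poly. \<forall>i\<ge>n. coeff p i = 0}"
    have U: "(UNIV :: bit set) = {0, 1}" using bit_not_one_iff by blast
    have eq: "?B (Suc n) = (\<lambda>(a, p). pCons a p) ` (UNIV \<times> ?B n)"
    proof (intro equalityI subsetI)
      fix p assume p: "p \<in> ?B (Suc n)"
      obtain a q where pq: "p = pCons a q" by (cases p)
      have "coeff q i = coeff p (Suc i)" for i using pq by simp
      hence "q \<in> ?B n" using p by auto
      thus "p \<in> (\<lambda>(a, p). pCons a p) ` (UNIV \<times> ?B n)" using pq by auto
    qed (auto simp: coeff_pCons split: nat.splits)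
    have inj: "inj_on (\<lambda>(a, p). pCons a p) (UNIV \<times> ?B n)" by (auto simp: inj_on_def)
    show ?case
      unfolding eq card_image[OF inj] using Suc.IH by (simp add: U card_cartesian_product)
  qed
  thus "finite {p :: bit poly. \<forall>i\<ge>n. coeff p i = 0}" "card {p :: bit poly. \<forall>i\<ge>n. coeff p i = 0} = 2 ^ n"
    by auto
qed

lemma bit_polys_degree:
  "finite {p :: bit poly. p \<noteq> 0 \<and> degree p = n}"
  "card {p :: bit poly. p \<noteq> 0 \<and> degree p = n} = 2 ^ n"
proof -
  let ?B = "\<lambda>n. {p :: bit poly. \<forall>i\<ge>n. coeff p i = 0}"
  have eq: "{p :: bit poly. p \<noteq> 0 \<and> degree p = n} = ?B (Suc n) - ?B n"
  proof (intro equalityI subsetI)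
    fix p :: "bit poly" assume "p \<in> {p. p \<noteq> 0 \<and> degree p = n}"
    thus "p \<in> ?B (Suc n) - ?B n"
      using leading_coeff_0_iff[of p] by (auto simp: coeff_eq_0 simp del: bit_not_zero_iff)
  next
    fix p :: "bit poly" assume p: "p \<in> ?B (Suc n) - ?B n"
    then obtain i where "i \<ge> n" "coeff p i \<noteq> 0" "\<not> i \<ge> Suc n" by blast
    hence "coeff p n \<noteq> 0" by (metis le_antisym not_less_eq_eq)
    moreover have "degree p \<le> n" using p by (intro degree_le) (auto simp: Suc_le_eq)
    ultimately show "p \<in> {p. p \<noteq> 0 \<and> degree p = n}"
      using le_degree by fastforce
  qed
  show "finite {p :: bit poly. p \<noteq> 0 \<and> degree p = n}"
    unfolding eq using bit_polys_coeff_bound(1) by auto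
  show "card {p :: bit poly. p \<noteq> 0 \<and> degree p = n} = 2 ^ n"
    unfolding eq using bit_polys_coeff_bound[of n] bit_polys_coeff_bound[of "Suc n"]
    by (subst card_Diff_subset) auto
qed

text \<open>Leading and constant coefficients are both 1, leaving \<open>n - 1\<close> free ones.
  For \<open>n = 0\<close> the two coincide, and truncated subtraction gives the correct count
  1.\<close>

lemma bit_polys_unit_constant_coeff:
  "card {p :: bit poly. poly p 0 \<noteq> 0 \<and> degree p = n} = 2 ^ (n - 1)"
proof (cases n)
  case 0
  have "{p :: bit poly. poly p 0 \<noteq> 0 \<and> degree p = 0} = {1}"
    by (auto simp: one_pCons elim!: degree_eq_zeroE)
  thus ?thesis using 0 by simp
next
  case (Suc k)
  have "{p :: bit poly. poly p 0 \<noteq> 0 \<and> degree p = Suc k} = pCons 1 ` {p. p \<noteq> 0 \<and> degree p = k}"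
  proof (intro equalityI subsetI)
    fix p :: "bit poly" assume p: "p \<in> {p. poly p 0 \<noteq> 0 \<and> degree p = Suc k}"
    obtain a q where "p = pCons a q" by (cases p)
    thus "p \<in> pCons 1 ` {p. p \<noteq> 0 \<and> degree p = k}"
      using p by (auto split: if_splits)
  qed auto
  thus ?thesis
    using Suc bit_polys_degree(2)[of k] by (simp add: card_image inj_on_def)
qed

subsection \<open>Primitive polynomials\<close>

text \<open>Because \<open>p\<close> is irreducible with root \<open>x\<close>, a congruence modulo
  \<open>p\<close> amounts to equality of values at \<open>x\<close>.\<close>

lemma has_period_iff_exact_order:
  fixes p :: "bit poly"
  assumes "irreducible p" "eval_ac p x = 0" "0 < n"
  shows "has_period p n \<longleftrightarrow> exact_order x n"
proof -
  have cong: "[monom 1 k = 1] (mod p) \<longleftrightarrow> x ^ k = 1" for k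
    using irreducible_eval_ac_eq_0_iff[OF assms(1,2), of "monom 1 k - 1"]
    by (simp add: cong_iff_dvd_diff del: minus_bit_def)
  show ?thesis
  proof
    assume "has_period p n"
    thus "exact_order x n" unfolding has_period_def cong
      by (intro exact_order_Least) auto
  next
    assume n: "exact_order x n"
    hence "x ^ n = 1" by (auto simp: exact_order_def)
    hence "p dvd monom 1 n - 1"
      using irreducible_eval_ac_eq_0_iff[OF assms(1,2), of "monom 1 n - 1"] by simp
    then obtain q where "monom 1 n - 1 = p * q" by auto
    \<comment> \<open>The constant coefficient of \<open>monom 1 n - 1\<close> is nonzero as
      \<open>n > 0\<close>, so that of its divisor \<open>p\<close> is too.\<close>
    hence "poly p 0 * poly q 0 = poly (monom 1 n - 1) 0" by (metis poly_mult)
    also have "\<dots> \<noteq> 0" using assms(3) by (simp add: poly_monom)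
    finally have "poly p 0 \<noteq> 0" by auto
    moreover have "n \<le> k" if "0 < k" "x ^ k = 1" for k
      using n that by (auto simp: exact_order_def intro: dvd_imp_le)
    ultimately show "has_period p n"
      using \<open>x ^ n = 1\<close> assms(3) unfolding has_period_def cong by blast
  qed
qed

text \<open>
  The values at \<open>x\<close> of the \<open>2 ^ degree m\<close> residues modulo \<open>m\<close> are distinct, are all fixed by the
  \<open>r\<close>-fold Frobenius map, and include the \<open>2 ^ r - 1\<close> powers of \<open>x\<close>.
\<close>
lemma degree_eq_of_exact_order:
  fixes m :: "bit poly"
  assumes m: "m \<noteq> 0" "\<And>p. eval_ac p x = 0 \<longleftrightarrow> m dvd p"
    and x: "exact_order x (2 ^ r - 1)" and "r > 0"
  shows "degree m = r"
proof (rule antisym)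
  let ?d = "degree m" and ?N = "2 ^ r - 1 :: nat"
  let ?B = "{p :: bit poly. \<forall>i\<ge>?d. coeff p i = 0}"
  let ?K = "{y :: bit alg_closure. y ^ (2 ^ r) = y}"
  have N: "2 ^ r = Suc ?N" "0 < ?N"
    using \<open>r > 0\<close> one_less_power[of "2::nat" r] by auto
  have B: "p \<in> ?B \<longleftrightarrow> p = 0 \<or> degree p < ?d" for p
  proof
    assume "p \<in> ?B"
    thus "p = 0 \<or> degree p < ?d" by (metis (mono_tags) leI leading_coeff_0_iff mem_Collect_eq)
  qed (auto simp: coeff_eq_0)
  have xN: "x ^ ?N = 1" using x by (simp add: exact_order_def)
  have Frob: "x ^ (2 ^ r) = x" using power_Suc[of x ?N] xN by (metis N(1) mult.right_neutral)
  have fixed: "(\<lambda>p. eval_ac p x) ` ?B \<subseteq> ?K"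
  proof (intro image_subsetI CollectI)
    fix p :: "bit poly"
    show "eval_ac p x ^ (2 ^ r) = eval_ac p x"
      by (simp only: eval_ac_bit_frobenius Frob)
  qed
  have inj: "inj_on (\<lambda>p. eval_ac p x) ?B"
  proof (rule inj_onI)
    fix p q assume pq: "p \<in> ?B" "q \<in> ?B" "eval_ac p x = eval_ac q x"
    hence "m dvd p - q" using m(2)[of "p - q"] by simp
    moreover have "p - q \<in> ?B" using pq by auto
    ultimately have "p - q = 0"
      using B[of "p - q"] dvd_imp_degree_le[of m "p - q"] by linarith
    thus "p = q" by simp
  qed
  \<comment> \<open>The fixed points \<open>?K\<close> are the roots of this polynomial, so there
    are at most \<open>2 ^ r\<close> of them; this bounds \<open>?d\<close> from above.\<close>
  define f :: "bit poly" where "f = monom 1 (2 ^ r) - monom 1 1"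
  have degf: "degree f = 2 ^ r"
    unfolding f_def using N(2) by (intro degree_monom_diff) (simp add: degree_monom_eq)
  hence f0: "f \<noteq> 0" by auto
  have K: "?K = {y. eval_ac f y = 0}" by (auto simp: f_def)
  have "2 ^ ?d = card ((\<lambda>p. eval_ac p x) ` ?B)"
    using card_image[OF inj] bit_polys_coeff_bound(2) by simp
  also have "\<dots> \<le> card ?K"
    by (rule card_mono[OF _ fixed]) (simp add: K finite_eval_ac_roots f0)
  also have "\<dots> \<le> 2 ^ r"
    using card_eval_ac_roots_le[OF f0] by (simp add: K degf)
  finally show "?d \<le> r" by (rule power_le_imp_le_exp[rotated]) simp
  have x0: "x \<noteq> 0" using xN N(2) by (auto simp: power_0_left)
  have inj': "inj_on (\<lambda>k. x ^ k) {..<?N}"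
  proof (rule linorder_inj_onI')
    fix i j assume ij: "i \<in> {..<?N}" "j \<in> {..<?N}" "i < j"
    show "x ^ i \<noteq> x ^ j"
    proof
      assume "x ^ i = x ^ j"
      also have "\<dots> = x ^ i * x ^ (j - i)" using ij by (simp flip: power_add)
      finally have "x ^ (j - i) = 1" using x0 by simp
      hence "?N dvd j - i" using x by (simp add: exact_order_def)
      thus False using ij by (auto dest: dvd_imp_le)
    qed
  qed
  \<comment> \<open>Lower bound on \<open>?d\<close>: reducing \<open>monom 1 k\<close> modulo
    \<open>m\<close> keeps its value at \<open>x\<close>, and that value is nonzero. So
    \<open>?N\<close> distinct powers come from at most \<open>2 ^ ?d - 1\<close> nonzero
    residues.\<close>
  have "(\<lambda>k. x ^ k) ` {..<?N} \<subseteq> (\<lambda>p. eval_ac p x) ` (?B - {0})"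
  proof
    fix y assume "y \<in> (\<lambda>k. x ^ k) ` {..<?N}"
    then obtain k where y: "y = x ^ k" by auto
    let ?p = "monom 1 k mod m"
    have e: "eval_ac ?p x = y" using eval_ac_mod[of m x] m(2)[of m] by (simp add: y)
    moreover have "?p \<in> ?B" unfolding B using degree_mod_less[OF m(1)] by blast
    moreover have "?p \<noteq> 0" using e x0 y by auto
    ultimately show "y \<in> (\<lambda>p. eval_ac p x) ` (?B - {0})" by blast
  qed
  hence "card ((\<lambda>k. x ^ k) ` {..<?N}) \<le> card ((\<lambda>p. eval_ac p x) ` (?B - {0}))"
    by (intro card_mono finite_imageI finite_Diff bit_polys_coeff_bound(1))
  hence "?N \<le> card ((\<lambda>p. eval_ac p x) ` (?B - {0}))"
    unfolding card_image[OF inj'] card_lessThan .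
  also have "\<dots> \<le> card (?B - {0})"
    by (rule card_image_le) (simp add: bit_polys_coeff_bound(1))
  also have "\<dots> = 2 ^ ?d - 1"
    using bit_polys_coeff_bound[of ?d] by (subst card_Diff_singleton) auto
  finally have "(2::nat) ^ r \<le> 2 ^ ?d"
    using N(2) by linarith
  thus "r \<le> ?d" by (rule power_le_imp_le_exp[rotated]) simp
qed

lemma primitive_polyD:
  assumes "primitive_poly p"
  shows "p \<noteq> 0" "irreducible p" "0 < degree p" "poly p 0 \<noteq> 0"
  using assms by (auto simp: primitive_poly_def has_period_def)

lemma finite_primitive_polys: "finite {p. primitive_poly p \<and> degree p = r}"
  by (rule finite_subset[OF _ bit_polys_degree(1)[of r]]) (auto dest: primitive_polyD)

text \<open>The period makes \<open>p\<close> a divisor of \<open>x ^ ?N - 1\<close>, which has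
  \<open>?N\<close> distinct roots because \<open>?N\<close> is odd.\<close>

lemma card_primitive_roots:
  assumes "primitive_poly p"
  shows "card {x. eval_ac p x = 0} = degree p"
proof -
  let ?N = "2 ^ degree p - 1 :: nat"
  let ?f = "monom 1 ?N - 1 :: bit poly"
  have pos: "0 < ?N"
    using primitive_polyD(3)[OF assms] one_less_power[of "2::nat" "degree p"] by simp
  have deg: "degree ?f = ?N"
    using pos by (intro degree_monom_diff) simp
  have "odd ?N" using primitive_polyD(3)[OF assms] by simp
  have "p dvd ?f"
    using assms by (auto simp: primitive_poly_def has_period_def cong_iff_dvd_diff)
  moreover have "?f \<noteq> 0" using deg pos by auto
  moreover have "card {x. eval_ac ?f x = 0} = degree ?f"
    using card_roots_of_unity[OF of_nat_ac_bit_neq_0[OF \<open>odd ?N\<close>]] unfolding deg by simp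
  ultimately show ?thesis by (rule card_eval_ac_roots_dvd)
qed

text \<open>The elements of order \<open>2 ^ r - 1\<close> are partitioned into root sets of size
  \<open>r\<close>. The product form avoids division of natural numbers.\<close>

lemma card_primitive_polys:
  assumes "r > 0"
  shows "card {p. primitive_poly p \<and> degree p = r} * r = totient (2 ^ r - 1)"
proof -
  let ?N = "2 ^ r - 1 :: nat"
  let ?I = "{p. primitive_poly p \<and> degree p = r}"
  let ?R = "\<lambda>p :: bit poly. {x. eval_ac p x = 0}"
  have pos: "0 < ?N" and odd: "odd ?N"
    using assms one_less_power[of "2::nat" r] by auto
  have "{x :: bit alg_closure. exact_order x ?N} = (\<Union>p\<in>?I. ?R p)"
  proof (intro equalityI subsetI)
    fix x :: "bit alg_closure" assume "x \<in> {x. exact_order x ?N}"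
    hence x: "exact_order x ?N" by simp
    obtain m :: "bit poly"
      where m: "m \<noteq> 0" "irreducible m" "\<And>p. eval_ac p x = 0 \<longleftrightarrow> m dvd p"
      using minimal_polynomial_exists[of x] by metis
    have deg: "degree m = r" using degree_eq_of_exact_order[OF m(1,3) x assms] .
    have 0: "eval_ac m x = 0" using m(3) by simp
    have "primitive_poly m"
      unfolding primitive_poly_def deg
      using assms m(2) has_period_iff_exact_order[OF m(2) 0 pos] x by simp
    with deg 0 show "x \<in> (\<Union>p\<in>?I. ?R p)" by auto
  next
    fix x assume "x \<in> (\<Union>p\<in>?I. ?R p)"
    then obtain p where p: "primitive_poly p" "degree p = r" "eval_ac p x = 0" by auto
    hence "has_period p ?N" by (auto simp: primitive_poly_def)
    thus "x \<in> {x. exact_order x ?N}"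
      using has_period_iff_exact_order[OF primitive_polyD(2)[OF p(1)] p(3) pos] by simp
  qed
  hence "totient ?N = card (\<Union>p\<in>?I. ?R p)"
    using card_exact_order[OF of_nat_ac_bit_neq_0[OF odd]] by simp
  also have "\<dots> = (\<Sum>p\<in>?I. card (?R p))"
  proof (rule card_UN_disjoint)
    show "\<forall>p\<in>?I. \<forall>q\<in>?I. p \<noteq> q \<longrightarrow> ?R p \<inter> ?R q = {}"
    proof (intro ballI impI)
      fix p q assume pq: "p \<in> ?I" "q \<in> ?I" "p \<noteq> q"
      \<comment> \<open>A common root makes the two irreducible polynomials divide each
        other.\<close>
      have "p = q" if "x \<in> ?R p \<inter> ?R q" for x
        using that pq irreducible_eval_ac_eq_0_iff[of p x q] irreducible_eval_ac_eq_0_iff[of q x p]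
        by (auto intro: bit_poly_dvd_antisym dest: primitive_polyD)
      thus "?R p \<inter> ?R q = {}" using pq by blast
    qed
  qed (auto simp: finite_primitive_polys intro!: finite_eval_ac_roots dest: primitive_polyD)
  also have "\<dots> = (\<Sum>p\<in>?I. r)"
    by (rule sum.cong) (auto simp: card_primitive_roots)
  finally show ?thesis by simp
qed

subsection \<open>Almost primitive polynomials\<close>

text \<open>Irreducible polynomials over a field are prime, and \<open>s\<close> is too small to be
  a multiple of \<open>p\<close>. So \<open>p\<close> divides the irreducible
  \<open>q\<close>.\<close>

lemma primitive_factor_unique:
  assumes "primitive_poly p" "primitive_poly q" "p dvd q * s" "s \<noteq> 0" "degree s < degree p"
  shows "p = q"
proof -
  have "prime_elem p"
    using field_poly_irreducible_imp_prime primitive_polyD(2)[OF assms(1)] .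
  hence "p dvd q \<or> p dvd s" using assms(3) by (simp add: prime_elem_dvd_mult_iff)
  hence "p dvd q" using assms(4,5) by (meson dvd_imp_degree_le leD)
  moreover have "q dvd p"
    using calculation primitive_polyD(2)[OF assms(1)] primitive_polyD(2)[OF assms(2)]
    by (meson irreducibleD' irreducible_not_unit)
  ultimately show ?thesis by (rule bit_poly_dvd_antisym)
qed

lemma card_almost_primitive:
  assumes "\<delta> < r"
  shows "card {p. almost_primitive p \<and> has_exponent_increment p r \<delta>}
       = card {p. primitive_poly p \<and> degree p = r} * 2 ^ (\<delta> - 1)"
proof -
  let ?I = "{p. primitive_poly p \<and> degree p = r}"
  let ?S = "{s :: bit poly. poly s 0 \<noteq> 0 \<and> degree s = \<delta>}"
  have "{p. almost_primitive p \<and> has_exponent_increment p r \<delta>} = (\<lambda>(q, s). q * s) ` (?I \<times> ?S)"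
  proof (intro equalityI subsetI)
    fix p assume "p \<in> {p. almost_primitive p \<and> has_exponent_increment p r \<delta>}"
    then obtain q where q: "primitive_poly q" "degree q = r" "q dvd p"
      and p: "poly p 0 \<noteq> 0" "degree p = r + \<delta>"
      by (auto simp: has_exponent_increment_def has_exponent_def)
    obtain s where s: "p = q * s" using q(3) by auto
    have "poly s 0 \<noteq> 0" using p(1) by (auto simp: s)
    moreover have "degree s = \<delta>"
      using p q(2) degree_mult_eq[of q s] by (cases "q = 0 \<or> s = 0") (auto simp: s)
    ultimately show "p \<in> (\<lambda>(q, s). q * s) ` (?I \<times> ?S)" using s q by blast
  next
    fix p assume "p \<in> (\<lambda>(q, s). q * s) ` (?I \<times> ?S)"
    then obtain q s where q: "primitive_poly q" "degree q = r"
      and s: "poly s 0 \<noteq> 0" "degree s = \<delta>" and p: "p = q * s" by auto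
    have "s \<noteq> 0" using s by auto
    hence "degree p = r + \<delta>" using q s primitive_polyD(1)[OF q(1)] by (simp add: p degree_mult_eq)
    \<comment> \<open>Here \<open>\<delta> < r\<close> gives \<open>degree p < 2 * r\<close>, the
      required bound on the exponent.\<close>
    moreover have "has_exponent p r"
      unfolding has_exponent_def
      using q s primitive_polyD(4)[OF q(1)] assms calculation by (auto simp: p)
    ultimately show "p \<in> {p. almost_primitive p \<and> has_exponent_increment p r \<delta>}"
      by (auto simp: almost_primitive_def has_exponent_increment_def)
  qed
  moreover have "inj_on (\<lambda>(q, s). q * s) (?I \<times> ?S)"
  proof (rule inj_onI)
    fix u v assume uv: "u \<in> ?I \<times> ?S" "v \<in> ?I \<times> ?S"
      "(\<lambda>(q, s). q * s) u = (\<lambda>(q, s). q * s) v"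
    obtain q s q' s' where [simp]: "u = (q, s)" "v = (q', s')" by (cases u, cases v)
    have eq: "q * s = q' * s'" and "s' \<noteq> 0" using uv by auto
    \<comment> \<open>The cofactor \<open>s'\<close> has degree \<open>\<delta> < r\<close>, so it
      cannot contain \<open>q\<close>; afterwards \<open>q\<close> cancels.\<close>
    hence "q = q'"
      using primitive_factor_unique[of q q' s'] uv assms by (auto intro: dvdI simp flip: eq)
    thus "u = v" using eq uv primitive_polyD(1)[of q] by auto
  qed
  ultimately show ?thesis
    using bit_polys_unit_constant_coeff[of \<delta>]
    by (simp add: card_image card_cartesian_product)
qed

theorem mainTheorem4:
  fixes r \<delta> :: nat and P\<^sub>r :: real
  assumes "\<delta> < r"
    and "P\<^sub>r = real (totient (2 ^ r - 1)) / real r"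
  shows "real (card {P :: bit poly. primitive_poly P \<and> degree P = r}) = P\<^sub>r \<and>
         real (card {P :: bit poly. almost_primitive P \<and> has_exponent_increment P r \<delta>})
           = 2 ^ nat (max 0 (int \<delta> - 1)) * P\<^sub>r"
proof -
  have "r > 0" using assms(1) by simp
  hence *: "real (card {P :: bit poly. primitive_poly P \<and> degree P = r}) = P\<^sub>r"
    using card_primitive_polys[of r] by (simp add: assms(2) field_simps flip: of_nat_mult)
  \<comment> \<open>Truncated subtraction on naturals is exactly this maximum.\<close>
  have "nat (max 0 (int \<delta> - 1)) = \<delta> - 1" by linarith
  with * show ?thesis by (simp add: card_almost_primitive[OF assms(1)])
qed

end
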